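(* Let $(H;(\cdot,\cdot))$ be an inner product space over $\mathbb{K}$, where $\mathbb{K}=\mathbb{R}$ or $\mathbb{K}=\mathbb{C}$, let $n\ge1$ and let $x,y_1,\dots,y_n\in H$. Then $$\sum_{i=1}^n|(x,y_i)|^2\le\|x\|\max_{1\le i\le n}|(x,y_i)|\Big\{\sum_{i=1}^n\|y_i\|^2+\sum_{1\le i\ne j\le n}|(y_i,y_j)|\Big\}^{\frac12}.$$
   Context: Here $\|v\|=(v,v)^{1/2}$. The sum over $1\le i\ne j\le n$ ranges over all ordered pairs $(i,j)\in\{1,\dots,n\}^2$ with $i\neq j$ (an empty sum is $0$). *)

theory Defs
  imports "HOL-Analysis.Analysis"
begin

text \<open>
  Real inner product spaces are the library class \<^class>\<open>real_inner\<close>. Complex ones are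
  introduced here. The inner product is linear in its first argument; that
  \<open>ip u u\<close> is real follows from conjugate symmetry.
\<close>

locale complex_inner_product_space = vector_space scale
  for scale :: "complex \<Rightarrow> 'a::ab_group_add \<Rightarrow> 'a" +
  fixes ip :: "'a \<Rightarrow> 'a \<Rightarrow> complex"
  assumes ip_commute: "ip u v = cnj (ip v u)"
    and ip_add_left: "ip (u + v) w = ip u w + ip v w"
    and ip_scale_left: "ip (scale c u) v = c * ip u v"
    and ip_ge_zero: "0 \<le> Re (ip u u)"
    and ip_eq_zero: "ip u u = 0 \<Longrightarrow> u = 0"

definition ip_norm :: "('a \<Rightarrow> 'a \<Rightarrow> complex) \<Rightarrow> 'a \<Rightarrow> real" where
  "ip_norm ip u = sqrt (Re (ip u u))"

end

theory Submission
  imports Defs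
begin

text \<open>
  Put \<open>c\<^sub>i = (x, y\<^sub>i)\<close> and \<open>u = \<Sum>\<^sub>i c\<^sub>i y\<^sub>i\<close>. The coefficients are chosen so that
  \<open>(x, u) = \<Sum>\<^sub>i \<bar>c\<^sub>i\<bar>\<^sup>2\<close>, the left-hand side, which the Cauchy--Schwarz inequality bounds
  by \<open>\<parallel>x\<parallel> \<parallel>u\<parallel>\<close>. Expanding \<open>\<parallel>u\<parallel>\<^sup>2\<close> into the Gram double sum of the terms
  \<open>c\<^sub>i (y\<^sub>i, y\<^sub>j)\<close> times the conjugate of \<open>c\<^sub>j\<close> and replacing each coefficient by the
  largest modulus gives \<open>\<parallel>u\<parallel>\<^sup>2 \<le> max\<^sub>i \<bar>c\<^sub>i\<bar>\<^sup>2 \<Sum>\<^sub>i\<^sub>,\<^sub>j \<bar>(y\<^sub>i, y\<^sub>j)\<bar>\<close>; the diagonal of this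
  sum is \<open>\<Sum>\<^sub>i \<parallel>y\<^sub>i\<parallel>\<^sup>2\<close>.

  The passage from these two facts to the inequality concerns real numbers only and is shared
  by the real and the complex case (\<open>max_bound_from_gram_bound\<close>). The complex case
  moreover needs the Cauchy--Schwarz inequality in the locale of complex inner product spaces.
\<close>

text \<open>
  The numbers \<open>a i\<close> stand for the moduli of the coefficients, \<open>g i j\<close> for the moduli of the
  Gram matrix entries, and \<open>q\<close> for \<open>\<parallel>u\<parallel>\<close>.
\<close>

lemma max_bound_from_gram_bound:
  fixes a :: "'i \<Rightarrow> real" and g :: "'i \<Rightarrow> 'i \<Rightarrow> real" and s p q :: real
  assumes fin: "finite A"
    and a: "\<And>i. i \<in> A \<Longrightarrow> 0 \<le> a i" and g: "\<And>i j. i \<in> A \<Longrightarrow> j \<in> A \<Longrightarrow> 0 \<le> g i j"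
    and p: "0 \<le> p" and q: "0 \<le> q" and ne: "A \<noteq> {}"
    and cs: "s \<le> p * q"
    and gram: "q\<^sup>2 \<le> (\<Sum>i\<in>A. \<Sum>j\<in>A. a i * a j * g i j)"
  shows "s \<le> p * Max (a ` A)
            * sqrt ((\<Sum>i\<in>A. g i i) + (\<Sum>(i, j)\<in>{(i, j). i \<in> A \<and> j \<in> A \<and> i \<noteq> j}. g i j))"
proof -
  let ?M = "Max (a ` A)" and ?O = "{(i, j). i \<in> A \<and> j \<in> A \<and> i \<noteq> j}"
  have a_le: "a i \<le> ?M" if "i \<in> A" for i
    using fin that by simp
  have M: "0 \<le> ?M"
    using ne a a_le by (meson ex_in_conv order_trans)
  have split: "A \<times> A = (\<lambda>i. (i, i)) ` A \<union> ?O"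
    by auto
  have finO: "finite ?O"
    by (rule finite_subset[of _ "A \<times> A"]) (use fin in auto)
  have "(\<Sum>i\<in>A. \<Sum>j\<in>A. g i j) = (\<Sum>(i, j)\<in>A \<times> A. g i j)"
    by (simp add: sum.cartesian_product)
  also have "\<dots> = (\<Sum>(i, j)\<in>(\<lambda>i. (i, i)) ` A. g i j) + (\<Sum>(i, j)\<in>?O. g i j)"
    unfolding split by (rule sum.union_disjoint) (use fin finO in auto)
  also have "(\<Sum>(i, j)\<in>(\<lambda>i. (i, i)) ` A. g i j) = (\<Sum>i\<in>A. g i i)"
    by (subst sum.reindex) (auto simp: inj_on_def)
  finally have G: "(\<Sum>i\<in>A. \<Sum>j\<in>A. g i j) = (\<Sum>i\<in>A. g i i) + (\<Sum>(i, j)\<in>?O. g i j)" .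
  have "q\<^sup>2 \<le> (\<Sum>i\<in>A. \<Sum>j\<in>A. ?M * ?M * g i j)"
    using gram by (rule order_trans) (intro sum_mono mult_right_mono mult_mono a_le M a g)
  also have "\<dots> = ?M\<^sup>2 * (\<Sum>i\<in>A. \<Sum>j\<in>A. g i j)"
    by (simp add: sum_distrib_left power2_eq_square)
  finally have "sqrt (q\<^sup>2) \<le> sqrt (?M\<^sup>2 * (\<Sum>i\<in>A. \<Sum>j\<in>A. g i j))"
    by (rule real_sqrt_le_mono)
  then have "q \<le> ?M * sqrt (\<Sum>i\<in>A. \<Sum>j\<in>A. g i j)"
    using q M by (simp add: real_sqrt_mult)
  then have "p * q \<le> p * (?M * sqrt (\<Sum>i\<in>A. \<Sum>j\<in>A. g i j))"
    using p by (rule mult_left_mono)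
  with cs G show ?thesis
    by (simp add: mult.assoc)
qed

context complex_inner_product_space
begin

lemma ip_add_right: "ip u (v + w) = ip u v + ip u w"
  by (metis complex_cnj_add ip_add_left ip_commute)

lemma ip_scale_right: "ip u (scale c v) = cnj c * ip u v"
  by (metis complex_cnj_mult ip_commute ip_scale_left)

lemma ip_zero_left: "ip 0 v = 0"
  using ip_add_left[of 0 0 v] by simp

lemma ip_zero_right: "ip u 0 = 0"
  using ip_add_right[of u 0 0] by simp

lemma ip_sum_left: "ip (\<Sum>i\<in>A. f i) v = (\<Sum>i\<in>A. ip (f i) v)"
  by (induction A rule: infinite_finite_induct) (simp_all add: ip_zero_left ip_add_left)

lemma ip_sum_right: "ip u (\<Sum>i\<in>A. f i) = (\<Sum>i\<in>A. ip u (f i))"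
  by (induction A rule: infinite_finite_induct) (simp_all add: ip_zero_right ip_add_right)

lemma ip_norm_nonneg: "0 \<le> ip_norm ip u"
  by (simp add: ip_norm_def ip_ge_zero)

lemma ip_self: "ip u u = of_real ((ip_norm ip u)\<^sup>2)"
proof -
  have "Im (ip u u) = 0"
    using arg_cong[OF ip_commute[of u u], of Im] by simp
  then show ?thesis
    by (simp add: ip_norm_def ip_ge_zero complex_eq_iff)
qed

lemma ip_norm_squared: "(ip_norm ip u)\<^sup>2 = cmod (ip u u)"
  by (simp add: ip_self norm_power)

text \<open>
  For \<open>v \<noteq> 0\<close> and up to the factor \<open>\<parallel>v\<parallel>\<^sup>2\<close>, the vector \<open>w\<close> below is the component of \<open>u\<close> orthogonal to \<open>v\<close>;
  scaling it avoids a division, and the inequality says that \<open>\<parallel>w\<parallel>\<^sup>2\<close> is not negative.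
\<close>

lemma ip_Cauchy_Schwarz: "cmod (ip u v) \<le> ip_norm ip u * ip_norm ip v"
proof (cases "v = 0")
  case True
  then show ?thesis
    by (simp add: ip_zero_right ip_norm_def)
next
  case False
  let ?a = "ip_norm ip u" and ?b = "ip_norm ip v" and ?c = "ip u v"
  define w where "w = scale (of_real (?b\<^sup>2)) u + scale (- ?c) v"
  have vu: "ip v u = cnj ?c"
    by (rule ip_commute)
  have "ip w w = of_real (?b\<^sup>2) * (of_real (?a\<^sup>2) * of_real (?b\<^sup>2) - ?c * cnj ?c)"
    unfolding w_def ip_add_left ip_add_right ip_scale_left ip_scale_right
    by (simp add: ip_self[of u] ip_self[of v] vu algebra_simps)
  also have "\<dots> = of_real (?b\<^sup>2 * (?a\<^sup>2 * ?b\<^sup>2 - (cmod ?c)\<^sup>2))"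
    by (simp flip: complex_norm_square)
  finally have "0 \<le> ?b\<^sup>2 * (?a\<^sup>2 * ?b\<^sup>2 - (cmod ?c)\<^sup>2)"
    using ip_ge_zero[of w] by simp
  moreover have "0 < ?b\<^sup>2"
    using False ip_eq_zero[of v] ip_self[of v] by auto
  ultimately have "(cmod ?c)\<^sup>2 \<le> (?a * ?b)\<^sup>2"
    by (simp add: zero_le_mult_iff power_mult_distrib)
  then show ?thesis
    by (rule power2_le_imp_le) (simp add: ip_norm_nonneg)
qed

theorem sum_ip_squared_le_max:
  assumes "finite A" and "A \<noteq> {}"
  shows "(\<Sum>i\<in>A. (cmod (ip x (y i)))\<^sup>2)
    \<le> ip_norm ip x * Max ((\<lambda>i. cmod (ip x (y i))) ` A)
      * sqrt ((\<Sum>i\<in>A. (ip_norm ip (y i))\<^sup>2)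
          + (\<Sum>(i, j)\<in>{(i, j). i \<in> A \<and> j \<in> A \<and> i \<noteq> j}. cmod (ip (y i) (y j))))"
proof -
  define u where "u = (\<Sum>i\<in>A. scale (ip x (y i)) (y i))"
  have "ip x u = of_real (\<Sum>i\<in>A. (cmod (ip x (y i)))\<^sup>2)"
    by (simp only: u_def ip_sum_right ip_scale_right of_real_sum complex_norm_square mult.commute)
  then have "cmod (ip x u) = (\<Sum>i\<in>A. (cmod (ip x (y i)))\<^sup>2)"
    by (simp only: norm_of_real) (simp add: sum_nonneg)
  then have cs: "(\<Sum>i\<in>A. (cmod (ip x (y i)))\<^sup>2) \<le> ip_norm ip x * ip_norm ip u"
    using ip_Cauchy_Schwarz[of x u] by simp
  have "ip u u = (\<Sum>i\<in>A. \<Sum>j\<in>A. ip x (y i) * cnj (ip x (y j)) * ip (y i) (y j))"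
    unfolding u_def ip_sum_left ip_sum_right ip_scale_left ip_scale_right
    by (subst sum.swap) (simp add: sum_distrib_left mult_ac)
  then have gram: "(ip_norm ip u)\<^sup>2
      \<le> (\<Sum>i\<in>A. \<Sum>j\<in>A. cmod (ip x (y i)) * cmod (ip x (y j)) * cmod (ip (y i) (y j)))"
    by (auto simp: ip_norm_squared norm_mult intro!: sum_norm_le)
  show ?thesis
    unfolding ip_norm_squared
    by (rule max_bound_from_gram_bound[OF assms(1) _ _ _ _ assms(2) cs gram])
      (simp_all add: ip_norm_nonneg)
qed

end

theorem sum_inner_squared_le_max:
  fixes x :: "'a::real_inner" and y :: "'i \<Rightarrow> 'a"
  assumes "finite A" and "A \<noteq> {}"
  shows "(\<Sum>i\<in>A. \<bar>inner x (y i)\<bar>\<^sup>2)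
    \<le> norm x * Max ((\<lambda>i. \<bar>inner x (y i)\<bar>) ` A)
      * sqrt ((\<Sum>i\<in>A. (norm (y i))\<^sup>2)
          + (\<Sum>(i, j)\<in>{(i, j). i \<in> A \<and> j \<in> A \<and> i \<noteq> j}. \<bar>inner (y i) (y j)\<bar>))"
proof -
  define u where "u = (\<Sum>i\<in>A. inner x (y i) *\<^sub>R y i)"
  have "inner x u = (\<Sum>i\<in>A. \<bar>inner x (y i)\<bar>\<^sup>2)"
    by (simp add: u_def inner_sum_right power2_eq_square)
  then have cs: "(\<Sum>i\<in>A. \<bar>inner x (y i)\<bar>\<^sup>2) \<le> norm x * norm u"
    using norm_cauchy_schwarz[of x u] by simp
  have "(norm u)\<^sup>2 = (\<Sum>i\<in>A. \<Sum>j\<in>A. inner x (y i) * inner x (y j) * inner (y i) (y j))"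
    unfolding u_def power2_norm_eq_inner inner_sum_left inner_sum_right
    by (subst sum.swap) (simp add: mult_ac)
  also have "\<dots> \<le> (\<Sum>i\<in>A. \<Sum>j\<in>A. \<bar>inner x (y i)\<bar> * \<bar>inner x (y j)\<bar> * \<bar>inner (y i) (y j)\<bar>)"
    by (intro sum_mono) (simp flip: abs_mult)
  finally have gram: "(norm u)\<^sup>2
      \<le> (\<Sum>i\<in>A. \<Sum>j\<in>A. \<bar>inner x (y i)\<bar> * \<bar>inner x (y j)\<bar> * \<bar>inner (y i) (y j)\<bar>)" .
  have norm_squared: "(norm (y i))\<^sup>2 = \<bar>inner (y i) (y i)\<bar>" for i
    by (simp add: power2_norm_eq_inner)
  show ?thesis
    unfolding norm_squared
    by (rule max_bound_from_gram_bound[OF assms(1) _ _ _ _ assms(2) cs gram]) simp_all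
qed

theorem mainTheorem4:
  fixes n :: nat
  assumes "n \<ge> 1"
  shows "(\<forall>(x :: 'a::real_inner) (y :: nat \<Rightarrow> 'a).
            (\<Sum>i\<in>{1..n}. \<bar>inner x (y i)\<bar>\<^sup>2)
              \<le> norm x * Max ((\<lambda>i. \<bar>inner x (y i)\<bar>) ` {1..n})
                * sqrt ((\<Sum>i\<in>{1..n}. (norm (y i))\<^sup>2)
                    + (\<Sum>(i, j)\<in>{(i, j). i \<in> {1..n} \<and> j \<in> {1..n} \<and> i \<noteq> j}. \<bar>inner (y i) (y j)\<bar>)))
       \<and> (\<forall>(scale :: complex \<Rightarrow> 'b::ab_group_add \<Rightarrow> 'b) (ip :: 'b \<Rightarrow> 'b \<Rightarrow> complex) (x :: 'b) (y :: nat \<Rightarrow> 'b).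
            complex_inner_product_space scale ip \<longrightarrow>
            (\<Sum>i\<in>{1..n}. (cmod (ip x (y i)))\<^sup>2)
              \<le> ip_norm ip x * Max ((\<lambda>i. cmod (ip x (y i))) ` {1..n})
                * sqrt ((\<Sum>i\<in>{1..n}. (ip_norm ip (y i))\<^sup>2)
                    + (\<Sum>(i, j)\<in>{(i, j). i \<in> {1..n} \<and> j \<in> {1..n} \<and> i \<noteq> j}. cmod (ip (y i) (y j)))))"
proof -
  have "finite {1..n}" and "{1..n} \<noteq> {}"
    using assms by auto
  then show ?thesis
    by (intro conjI allI impI sum_inner_squared_le_max
        complex_inner_product_space.sum_ip_squared_le_max)
qed

end
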